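(* Let $\mathbf{a}=\{a_1,a_2,a_3,a_4\}$ be relatively prime positive integers minimally generating a semigroup $\langle\mathbf{a}\rangle$. Suppose that a principal matrix $A$ of $\mathbf{a}$ has rank $2$. Then, after a permutation of the entries $a_1,\dots,a_4$ if necessary (with the corresponding simultaneous permutation of rows and columns of $A$), there are positive integers $d,e,c_1,c_2,c_3,c_4$ with $\gcd(d,e)=\gcd(c_1,c_2)=\gcd(c_3,c_4)=1$ such that, as sets, $\{a_1,a_2\}=d\{c_1,c_2\}$ and $\{a_3,a_4\}=e\{c_3,c_4\}$, so that $\mathbf{a}=d\{c_1,c_2\}\sqcup e\{c_3,c_4\}$, and $$A=\begin{bmatrix} -c_{1} & c_2 & 0 &0 \\ c_1&-c_{2}&0&0\\0&0&-c_{3}&c_4\\0&0&c_3&-c_{4}\end{bmatrix}.$$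
   Context: For a set $\mathbf{a}=\{a_1,\dots,a_n\}$ of positive integers, $\langle \mathbf{a}\rangle$ denotes the additive monoid of all non-negative integer combinations of the $a_i$. If $\mathbf{a}$ minimally generates $\langle\mathbf{a}\rangle$, a principal matrix of $\mathbf{a}$ is an $n\times n$ integer matrix $A$ with diagonal entries $-c_1,\dots,-c_n$ and non-negative off-diagonal entries $a_{ij}$ such that $A(a_1,\dots,a_n)^T=0$ and, for each $i$, $c_i$ is the smallest positive integer with $c_ia_i\in\langle \mathbf{a}\setminus\{a_i\}\rangle$. "Relatively prime" means that $\gcd(a_1,a_2,a_3,a_4)=1$. For a set $S$ of integers and an integer $d$, $dS=\{ds: s\in S\}$. *)

theory Defs
  imports "HOL-Analysis.Analysis"
begin

text \<open>The definition below is meant for finite \<open>S\<close> only: over an infinite set the sum is \<open>0\<close>.\<close>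

definition monoid_gen :: "int set \<Rightarrow> int set" where
  "monoid_gen S = {\<Sum>s\<in>S. int (k s) * s |k. True}"

definition minimal_generators :: "int set \<Rightarrow> bool" where
  "minimal_generators S \<longleftrightarrow> (\<forall>T. T \<subset> S \<longrightarrow> monoid_gen T \<noteq> monoid_gen S)"

text \<open>
  A set \<open>{a\<^sub>1, \<dots>, a\<^sub>n}\<close> is represented by the vector \<open>a\<close> listing its elements, assumed to have
  pairwise distinct entries. Then \<open>range (($) a) - {a $ i}\<close> is the set without \<open>a\<^sub>i\<close>.
\<close>

definition principal_coeff :: "int ^ 'n \<Rightarrow> 'n \<Rightarrow> int \<Rightarrow> bool" where
  "principal_coeff a i c \<longleftrightarrow>
     0 < c \<and> c * a $ i \<in> monoid_gen (range (($) a) - {a $ i}) \<and>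
     (\<forall>m. 0 < m \<and> m * a $ i \<in> monoid_gen (range (($) a) - {a $ i}) \<longrightarrow> c \<le> m)"

definition principal_matrix :: "int ^ 'n \<Rightarrow> int ^ 'n ^ 'n \<Rightarrow> bool" where
  "principal_matrix a A \<longleftrightarrow>
     (\<forall>i. principal_coeff a i (- (A $ i $ i))) \<and>
     (\<forall>i j. i \<noteq> j \<longrightarrow> 0 \<le> A $ i $ j) \<and>
     A *v a = 0"

end

theory Submission
  imports Defs
begin

text \<open>
  Scaling column \<open>j\<close> of \<open>A\<close> by \<open>a\<^sub>j\<close> gives a matrix with non-negative off-diagonal entries and zero row
  sums, i.e. the generator of a Markov chain on four states. Rank \<open>2\<close> provides a kernel vector \<open>x\<close> of
  \<open>A\<close> that is not proportional to \<open>a\<close>, so \<open>x\<^sub>i / a\<^sub>i\<close> is a non-constant harmonic function. By the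
  maximum principle the sets where it is maximal and minimal are closed: no entry of \<open>A\<close> leads out of
  them. As \<open>A\<close> has negative diagonal, each closed set has at least two elements, so these
  two are complementary pairs and \<open>A\<close> splits into two blocks. Within a block the minimality of the
  \<open>c\<^sub>i\<close> determines the entries.
\<close>

section \<open>Kernel vectors, the maximum principle and closed sets\<close>

lemma exists_kernel_vector_zero_coordinate:
  fixes A :: "'a::field ^ 'n ^ 'm" and k :: 'n
  assumes "rank A + 1 < CARD('n)"
  obtains x where "A *v x = 0" "x \<noteq> 0" "x $ k = 0"
proof -
  \<comment> \<open>\<open>C\<close> is \<open>A\<close> with one more row, a unit vector, at the
    index \<open>None\<close>; its kernel consists of the kernel vectors of \<open>A\<close> that
    vanish at \<open>k\<close>. The new row raises the rank by at most one, so the rows of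
    \<open>C\<close> still cannot span the space and the kernel is nontrivial.\<close>
  define C :: "'a ^ 'n ^ 'm option"
    where "C = (\<chi> i. case i of None \<Rightarrow> axis k 1 | Some j \<Rightarrow> A $ j)"
  have C: "C $ None = axis k 1" "C $ Some j = A $ j" for j
    by (simp_all add: C_def)
  have "rows C = insert (axis k 1) (rows A)"
  proof -
    have rows: "rows B = range (($) B)" for B :: "'a ^ 'n ^ 'i"
      by (auto simp: rows_def row_def)
    show ?thesis
      unfolding rows UNIV_option_conv by (simp add: C image_image)
  qed
  then have "vec.dim (rows C) < CARD('n)"
    using assms unfolding row_rank_def_gen by (simp add: vec.dim_insert)
  then have "vec.dim (vec.span (rows C)) \<noteq> vec.dim (UNIV :: ('a ^ 'n) set)"
    by (simp add: vec_dim_card del: vec.dim_UNIV)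
  then have "vec.span (rows C) \<noteq> UNIV"
    by metis
  then obtain x where "C *v x = 0" "x \<noteq> 0"
    using matrix_left_invertible_span_rows_gen[of C] matrix_left_invertible_ker[of C] by auto
  then have *: "(C *v x) $ i = 0" for i
    by simp
  have "A *v x = 0"
    using *[of "Some _"] by (simp add: vec_eq_iff matrix_vector_mult_def C)
  moreover have "x $ k = 0"
    using *[of None] by (simp add: matrix_vector_mult_def C axis_def if_distrib[of "\<lambda>y. y * _"] cong: if_cong)
  ultimately show ?thesis
    using that \<open>x \<noteq> 0\<close> by blast
qed

text \<open>Put \<open>h l = x $ l / a $ l\<close>. The two kernel equations make the sum over
  \<open>l\<close> of \<open>A $ i $ l * a $ l * (h i - h l)\<close> vanish. At a maximum of
  \<open>h\<close> no term is negative, so each is zero, and at \<open>j\<close> the other two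
  factors are positive.\<close>

lemma zero_outside_argmax:
  fixes A :: "'a::linordered_field ^ 'n ^ 'n"
  assumes nonneg: "\<And>i j. i \<noteq> j \<Longrightarrow> 0 \<le> A $ i $ j"
    and pos: "\<And>i. 0 < a $ i"
    and Aa: "A *v a = 0" and Ax: "A *v x = 0"
    and i: "\<forall>j. x $ j / a $ j \<le> x $ i / a $ i"
    and j: "x $ j / a $ j < x $ i / a $ i"
  shows "A $ i $ j = 0"
proof -
  let ?h = "\<lambda>l. x $ l / a $ l"
  let ?t = "\<lambda>l. A $ i $ l * a $ l * (?h i - ?h l)"
  have nz: "a $ l \<noteq> 0" for l
    using pos[of l] by simp
  have "(\<Sum>l\<in>UNIV. A $ i $ l * a $ l) = 0" "(\<Sum>l\<in>UNIV. A $ i $ l * x $ l) = 0"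
    using Aa Ax by (simp_all add: vec_eq_iff matrix_vector_mult_def)
  moreover have "(\<Sum>l\<in>UNIV. ?t l) =
      ?h i * (\<Sum>l\<in>UNIV. A $ i $ l * a $ l) - (\<Sum>l\<in>UNIV. A $ i $ l * x $ l)"
    unfolding sum_distrib_left sum_subtractf[symmetric]
    using nz by (intro sum.cong refl) (simp add: field_simps)
  ultimately have "(\<Sum>l\<in>UNIV. ?t l) = 0"
    by simp
  moreover have "0 \<le> ?t l" for l
  proof (cases "l = i")
    case False
    then show ?thesis
      using nonneg[of i l] pos[of l] i by simp
  qed simp
  ultimately have "?t j = 0"
    by (simp add: sum_nonneg_eq_0_iff)
  then show ?thesis
    using nz j by auto
qed

lemma disjoint_closed_sets:
  fixes A :: "int ^ 'n ^ 'n" and a :: "int ^ 'n"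
  assumes nonneg: "\<And>i j. i \<noteq> j \<Longrightarrow> 0 \<le> A $ i $ j"
    and pos: "\<And>i. 0 < a $ i"
    and Aa: "A *v a = 0"
    and rank: "rank (map_matrix rat_of_int A) + 1 < CARD('n)"
  obtains M N where "M \<noteq> {}" "N \<noteq> {}" "M \<inter> N = {}"
    "\<And>i j. i \<in> M \<Longrightarrow> j \<notin> M \<Longrightarrow> A $ i $ j = 0"
    "\<And>i j. i \<in> N \<Longrightarrow> j \<notin> N \<Longrightarrow> A $ i $ j = 0"
proof -
  let ?A = "map_matrix rat_of_int A"
  \<comment> \<open>The ratios \<open>x $ i / a $ i\<close> need a field, hence the passage to
    rationals.\<close>
  define b where "b = (\<chi> i. rat_of_int (a $ i))"
  obtain k :: 'n where True by simp
  obtain x where Ax: "?A *v x = 0" and "x \<noteq> 0" and xk: "x $ k = 0"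
    using exists_kernel_vector_zero_coordinate[OF rank] .
  have posb: "0 < b $ i" for i
    using pos by (simp add: b_def)
  have nonnegA: "0 \<le> ?A $ i $ j" if "i \<noteq> j" for i j
    using nonneg that by simp
  have "(\<Sum>j\<in>UNIV. A $ i $ j * a $ j) = 0" for i
    using Aa by (simp add: vec_eq_iff matrix_vector_mult_def)
  from this[THEN arg_cong[where f = rat_of_int]] have Ab: "?A *v b = 0"
    by (simp add: vec_eq_iff matrix_vector_mult_def b_def)
  have argmax: "\<exists>i. \<forall>j. f j \<le> f i" for f :: "'n \<Rightarrow> rat"
  proof -
    have "Max (range f) \<in> range f"
      by (intro Max_in) auto
    then show ?thesis
      by (metis Max_ge finite finite_imageI rangeE rangeI)
  qed
  define h where "h i = x $ i / b $ i" for i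
  \<comment> \<open>The minimum set of \<open>h\<close> is treated as the maximum set of
    \<open>- h\<close>, so one maximum principle, applied to \<open>x\<close> and to
    \<open>- x\<close>, serves both.\<close>
  define argmax_set where "argmax_set f = {i. \<forall>j. f j \<le> f i}" for f :: "'n \<Rightarrow> rat"
  show ?thesis
  proof
    show "argmax_set h \<noteq> {}" "argmax_set (\<lambda>i. - h i) \<noteq> {}"
      unfolding argmax_set_def using argmax[of h] argmax[of "\<lambda>i. - h i"] by auto
    \<comment> \<open>\<open>h\<close> vanishes at \<open>k\<close> but not at \<open>l\<close>,
      while a common point of the maximum and minimum sets would make \<open>h\<close>
      constant.\<close>
    obtain l where "x $ l \<noteq> 0"
      using \<open>x \<noteq> 0\<close> by (auto simp: vec_eq_iff)
    then have "h l \<noteq> h k"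
      using posb[of l] xk by (simp add: h_def)
    then show "argmax_set h \<inter> argmax_set (\<lambda>i. - h i) = {}"
      unfolding argmax_set_def by (auto, metis order_antisym)
  next
    fix i j assume ij: "i \<in> argmax_set h" "j \<notin> argmax_set h"
    then have "h j < h i"
      unfolding argmax_set_def by (auto simp: not_le) (meson le_less_trans less_le_trans)
    then show "A $ i $ j = 0"
      using zero_outside_argmax[of ?A b x i j, OF nonnegA posb Ab Ax] ij
      by (simp add: argmax_set_def h_def)
  next
    fix i j assume ij: "i \<in> argmax_set (\<lambda>i. - h i)" "j \<notin> argmax_set (\<lambda>i. - h i)"
    then have "- h j < - h i"
      unfolding argmax_set_def by (auto simp: not_le) (meson le_less_trans less_le_trans)
    moreover have "?A *v (- x) = 0"
      using Ax by (simp add: vec.neg)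
    ultimately show "A $ i $ j = 0"
      using zero_outside_argmax[of ?A b "- x" i j, OF nonnegA posb Ab] ij
      by (simp add: argmax_set_def h_def)
  qed
qed

section \<open>Closed pairs and minimality of the principal coefficients\<close>

lemma mult_in_monoid_gen:
  assumes "finite S" "s \<in> S" "0 \<le> k"
  shows "k * s \<in> monoid_gen S"
proof -
  have "k * s = (\<Sum>t\<in>S. int (if t = s then nat k else 0) * t)"
    using assms by (simp add: if_distrib[of int] if_distrib[of "\<lambda>x. x * _"] cong: if_cong)
  then show ?thesis
    unfolding monoid_gen_def by fast
qed

text \<open>This is the form in which minimality is used. Injectivity matters: the value
  \<open>a $ i\<close> is removed from the set, and \<open>a $ j\<close> survives only because it
  differs.\<close>

lemma principal_coeff_le:
  fixes a :: "int ^ 'n"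
  assumes "principal_coeff a i c" "inj (($) a)" "i \<noteq> j" "0 < m" "0 \<le> k"
    and "m * a $ i = k * a $ j"
  shows "c \<le> m"
proof -
  have "a $ j \<in> range (($) a) - {a $ i}"
    using assms(2,3) by (auto dest: injD)
  then have "k * a $ j \<in> monoid_gen (range (($) a) - {a $ i})"
    using assms(5) by (intro mult_in_monoid_gen) auto
  then show ?thesis
    using assms(1,4,6) by (auto simp: principal_coeff_def)
qed

lemma principal_matrix_closed_pair:
  fixes a :: "int ^ 'n" and A :: "int ^ 'n ^ 'n"
  assumes inj: "inj (($) a)" and pos: "\<And>i. 0 < a $ i"
    and pm: "principal_matrix a A"
    and pq: "p \<noteq> q"
    and closed: "\<And>i j. i \<in> {p, q} \<Longrightarrow> j \<notin> {p, q} \<Longrightarrow> A $ i $ j = 0"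
  obtains d c c' where "0 < d" "0 < c" "0 < c'" "gcd c c' = 1"
    "a $ p = d * c'" "a $ q = d * c"
    "A $ p $ p = - c" "A $ p $ q = c'" "A $ q $ p = c" "A $ q $ q = - c'"
proof -
  define c c' where "c = - A $ p $ p" and "c' = - A $ q $ q"
  have pc: "principal_coeff a p c" "principal_coeff a q c'"
    using pm by (auto simp: principal_matrix_def c_def c'_def)
  then have cpos: "0 < c" "0 < c'"
    by (auto simp: principal_coeff_def)
  have nonneg: "0 \<le> A $ p $ q" "0 \<le> A $ q $ p"
    using pm pq by (auto simp: principal_matrix_def)
  have row: "(\<Sum>j\<in>UNIV. A $ i $ j * a $ j) = 0" for i
    using pm by (simp add: principal_matrix_def vec_eq_iff matrix_vector_mult_def)
  have row': "A $ i $ p * a $ p + A $ i $ q * a $ q = 0" if "i \<in> {p, q}" for i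
  proof -
    have "(\<Sum>j\<in>{p, q}. A $ i $ j * a $ j) = (\<Sum>j\<in>UNIV. A $ i $ j * a $ j)"
      using closed that by (intro sum.mono_neutral_left) auto
    then show ?thesis
      using pq row by simp
  qed
  have eq: "c * a $ p = A $ p $ q * a $ q" "c' * a $ q = A $ q $ p * a $ p"
    using row'[of p] row'[of q] by (simp_all add: c_def c'_def)
  have "0 < A $ p $ q * a $ q" "0 < A $ q $ p * a $ p"
    using cpos pos by (simp_all flip: eq)
  then have off: "0 < A $ p $ q" "0 < A $ q $ p"
    using pos by (simp_all add: zero_less_mult_iff less_not_sym)
  \<comment> \<open>Each row equation writes a multiple of one entry as a multiple of the other, so
    each off-diagonal entry competes with the diagonal coefficient of its column. The two bounds
    then pinch: \<open>c * a $ p = A $ p $ q * a $ q \<ge> c' * a $ q = A $ q $ p * a $ p \<ge> c *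
    a $ p\<close>.\<close>
  have le: "c' \<le> A $ p $ q" "c \<le> A $ q $ p"
    using principal_coeff_le[OF pc(2) inj _ off(1)] principal_coeff_le[OF pc(1) inj _ off(2)]
      pq cpos eq by (metis less_imp_le)+
  have "A $ p $ q * a $ q \<le> c' * a $ q"
    using mult_right_mono[OF le(2), of "a $ p"] pos[of p] eq by simp
  then have Apq: "A $ p $ q = c'"
    using le pos[of q] by simp
  then have Aqp: "A $ q $ p = c"
    using eq pos[of p] by (metis less_irrefl mult_right_cancel)
  have main: "c * a $ p = c' * a $ q"
    using eq Apq by simp
  \<comment> \<open>Dividing \<open>main\<close> by \<open>g\<close> gives the admissible multiplier
    \<open>c div g\<close>, so minimality of \<open>c\<close> forces \<open>g = 1\<close>.\<close>
  define g where "g = gcd c c'"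
  have g: "0 < g" "c = g * (c div g)" "c' = g * (c' div g)"
    using cpos by (simp_all add: g_def)
  have div_pos: "0 < c div g" "0 < c' div g"
    using g cpos by (metis zero_less_mult_pos)+
  have "g * (c div g * a $ p) = g * (c' div g * a $ q)"
    using main g by (metis mult.assoc)
  then have "c \<le> c div g"
    using g(1) div_pos pq by (intro principal_coeff_le[OF pc(1) inj, of q _ "c' div g"]) auto
  then have "g * (c div g) \<le> 1 * (c div g)"
    using g(2) by simp
  then have "g = 1"
    using g(1) div_pos(1) by (simp only: mult_le_cancel_right) simp
  then have cop: "gcd c c' = 1"
    by (simp add: g_def)
  then have "c' dvd a $ p"
    using main by (metis coprime_commute coprime_dvd_mult_right_iff coprime_iff_gcd_eq_1 dvd_triv_left)
  then obtain d where d: "a $ p = d * c'"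
    by (metis dvdE mult.commute)
  then have "c' * (d * c) = c' * a $ q"
    using main by (simp add: algebra_simps)
  then have "a $ q = d * c"
    using cpos by simp
  moreover have "0 < d"
    using d pos[of p] cpos by (metis zero_less_mult_pos2)
  moreover have "A $ p $ p = - c" "A $ q $ q = - c'"
    by (simp_all add: c_def c'_def)
  ultimately show ?thesis
    using cpos cop d Apq Aqp by (intro that[of d c c'])
qed

text \<open>In a closed singleton the row of \<open>p\<close> would keep only its diagonal term, a
  negative number times \<open>a $ p\<close>, which cannot be zero.\<close>

lemma closed_card_ge_2:
  fixes A :: "int ^ 'n ^ 'n"
  assumes pos: "\<And>i. 0 < a $ i" and pm: "principal_matrix a A"
    and "M \<noteq> {}" and closed: "\<And>i j. i \<in> M \<Longrightarrow> j \<notin> M \<Longrightarrow> A $ i $ j = 0"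
  shows "2 \<le> card M"
proof (rule ccontr)
  assume "\<not> 2 \<le> card M"
  moreover have "card M \<noteq> 0"
    using \<open>M \<noteq> {}\<close> by simp
  ultimately have "card M = 1"
    by linarith
  then obtain p where M: "M = {p}"
    by (auto simp: card_1_singleton_iff)
  have "(\<Sum>j\<in>{p}. A $ p $ j * a $ j) = (\<Sum>j\<in>UNIV. A $ p $ j * a $ j)"
    using closed M by (intro sum.mono_neutral_left) auto
  also have "\<dots> = 0"
    using pm by (simp add: principal_matrix_def vec_eq_iff matrix_vector_mult_def)
  finally show False
    using pos[of p] pm by (auto simp: principal_matrix_def principal_coeff_def) (metis less_irrefl neg_0_equal_iff_equal)
qed

section \<open>Assembly of the two blocks\<close>

lemma vector_4:
  "(vector [w, x, y, z] :: 'a::zero ^ 4) $ 1 = w"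
  "(vector [w, x, y, z] :: 'a ^ 4) $ 2 = x"
  "(vector [w, x, y, z] :: 'a ^ 4) $ 3 = y"
  "(vector [w, x, y, z] :: 'a ^ 4) $ 4 = z"
  by (simp_all add: vector_def)

theorem theorem17:
  fixes a :: "int ^ 4" and A :: "int ^ 4 ^ 4"
  assumes "inj (($) a)"
    and "\<forall>i. 0 < a $ i"
    and "Gcd (range (($) a)) = 1"
    and "minimal_generators (range (($) a))"
    and "principal_matrix a A"
    and "rank (map_matrix rat_of_int A) = 2"
  shows "\<exists>\<sigma>. \<sigma> permutes UNIV \<and>
    (\<exists>d e c1 c2 c3 c4 :: int.
       0 < d \<and> 0 < e \<and> 0 < c1 \<and> 0 < c2 \<and> 0 < c3 \<and> 0 < c4 \<and>
       gcd d e = 1 \<and> gcd c1 c2 = 1 \<and> gcd c3 c4 = 1 \<and>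
       {a $ \<sigma> 1, a $ \<sigma> 2} = (\<lambda>s. d * s) ` {c1, c2} \<and>
       {a $ \<sigma> 3, a $ \<sigma> 4} = (\<lambda>s. e * s) ` {c3, c4} \<and>
       range (($) a) = (\<lambda>s. d * s) ` {c1, c2} \<union> (\<lambda>s. e * s) ` {c3, c4} \<and>
       (\<lambda>s. d * s) ` {c1, c2} \<inter> (\<lambda>s. e * s) ` {c3, c4} = {} \<and>
       (\<chi> i j. A $ \<sigma> i $ \<sigma> j) =
         vector [vector [- c1, c2, 0, 0],
                 vector [c1, - c2, 0, 0],
                 vector [0, 0, - c3, c4],
                 vector [0, 0, c3, - c4]])"
proof -
  note inj = assms(1) and pm = assms(5)
  have pos: "0 < a $ i" for i
    using assms(2) by blast
  obtain M N where MN: "M \<noteq> {}" "N \<noteq> {}" "M \<inter> N = {}"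
    and closedM: "\<And>i j. i \<in> M \<Longrightarrow> j \<notin> M \<Longrightarrow> A $ i $ j = 0"
    and closedN: "\<And>i j. i \<in> N \<Longrightarrow> j \<notin> N \<Longrightarrow> A $ i $ j = 0"
  proof (rule disjoint_closed_sets[of A a])
    show "rank (map_matrix rat_of_int A) + 1 < CARD(4)"
      using assms(6) by simp
  qed (use pm pos in \<open>auto simp: principal_matrix_def\<close>)
  \<comment> \<open>Two disjoint sets of at least two elements each must split the four indices into
    pairs.\<close>
  have "2 \<le> card M" "2 \<le> card N"
    using closed_card_ge_2[OF pos pm] MN closedM closedN by blast+
  moreover have "card M + card N \<le> 4"
    using MN card_Un_disjoint[of M N] card_mono[of UNIV "M \<union> N"] by simp
  ultimately have "card M = 2" "card N = 2"
    by linarith+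
  then obtain p q r s where M: "M = {p, q}" "p \<noteq> q" and N: "N = {r, s}" "r \<noteq> s"
    by (auto simp: card_2_iff)
  have distinct: "p \<noteq> r" "p \<noteq> s" "q \<noteq> r" "q \<noteq> s"
    using MN M N by auto
  \<comment> \<open>The factors cross over: \<open>a $ p\<close> carries \<open>c2\<close> although
    the diagonal entry at \<open>p\<close> is \<open>- c1\<close>. The equalities of sets in the
    conclusion absorb this swap.\<close>
  obtain d c1 c2 where dc: "0 < d" "0 < c1" "0 < c2" "gcd c1 c2 = 1"
    "a $ p = d * c2" "a $ q = d * c1"
    and Apq: "A $ p $ p = - c1" "A $ p $ q = c2" "A $ q $ p = c1" "A $ q $ q = - c2"
    using principal_matrix_closed_pair[OF inj pos pm M(2) closedM[unfolded M(1)]] .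
  obtain e c3 c4 where ec: "0 < e" "0 < c3" "0 < c4" "gcd c3 c4 = 1"
    "a $ r = e * c4" "a $ s = e * c3"
    and Ars: "A $ r $ r = - c3" "A $ r $ s = c4" "A $ s $ r = c3" "A $ s $ s = - c4"
    using principal_matrix_closed_pair[OF inj pos pm N(2) closedN[unfolded N(1)]] .
  define \<sigma> :: "4 \<Rightarrow> 4"
    where "\<sigma> i = (if i = 1 then p else if i = 2 then q else if i = 3 then r else s)" for i
  have \<sigma>: "\<sigma> 1 = p" "\<sigma> 2 = q" "\<sigma> 3 = r" "\<sigma> 4 = s"
    by (simp_all add: \<sigma>_def)
  have "inj \<sigma>"
    unfolding inj_def forall_4 \<sigma> using M N distinct by auto
  then have surj: "surj \<sigma>"
    by (simp add: finite_UNIV_inj_surj)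
  have permutes: "\<sigma> permutes UNIV"
    using \<open>inj \<sigma>\<close> surj by (intro bij_imp_permutes) (auto simp: bij_betw_def)
  have "range (($) a) = (\<lambda>i. a $ \<sigma> i) ` UNIV"
    using surj by (simp add: image_image[symmetric])
  also have "\<dots> = {a $ p, a $ q, a $ r, a $ s}"
    by (simp add: UNIV_4 \<sigma>)
  finally have range: "range (($) a) = {a $ p, a $ q, a $ r, a $ s}" .
  \<comment> \<open>Every entry is a multiple of \<open>d\<close> or of \<open>e\<close>, so
    \<open>gcd d e\<close> divides the gcd of all entries, which is 1.\<close>
  have "gcd d e dvd x" if "x \<in> range (($) a)" for x
    using that unfolding range dc ec by (auto intro: dvd_mult2)
  then have "gcd d e dvd 1"
    using Gcd_greatest[of "range (($) a)" "gcd d e"] assms(3) by simp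
  then have "gcd d e = 1"
    by simp
  moreover have "{a $ \<sigma> 1, a $ \<sigma> 2} = (\<lambda>s. d * s) ` {c1, c2}"
    using dc by (auto simp: \<sigma>)
  moreover have "{a $ \<sigma> 3, a $ \<sigma> 4} = (\<lambda>s. e * s) ` {c3, c4}"
    using ec by (auto simp: \<sigma>)
  moreover have "range (($) a) = (\<lambda>s. d * s) ` {c1, c2} \<union> (\<lambda>s. e * s) ` {c3, c4}"
    unfolding range dc ec by auto
  moreover have "(\<lambda>s. d * s) ` {c1, c2} \<inter> (\<lambda>s. e * s) ` {c3, c4} = {}"
  proof -
    have "{a $ p, a $ q} \<inter> {a $ r, a $ s} = {}"
      using distinct by (auto dest: injD[OF inj])
    then show ?thesis
      unfolding dc ec by auto
  qed
  moreover have "(\<chi> i j. A $ \<sigma> i $ \<sigma> j) =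
         vector [vector [- c1, c2, 0, 0],
                 vector [c1, - c2, 0, 0],
                 vector [0, 0, - c3, c4],
                 vector [0, 0, c3, - c4]]"
    \<comment> \<open>Closedness of \<open>M\<close> and of \<open>N\<close> gives the two
      off-diagonal zero blocks.\<close>
    using closedM closedN distinct
    by (simp add: vec_eq_iff forall_4 vector_4 \<sigma> Apq Ars M(1) N(1))
  ultimately show ?thesis
    using permutes dc ec
    by (intro exI[of _ \<sigma>] exI[of _ d] exI[of _ e] exI[of _ c1] exI[of _ c2] exI[of _ c3]
        exI[of _ c4] conjI)
qed

end
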